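(* Let $\omega\in(0,\tfrac18)$, let $P^k=\{p\text{-data }(x_i^k,y_i^k,z_i^k)\}_{i\in\mathbb{Z}}$ be a sequence of points of $\mathbb{R}^3$, and let $P^{k+1}=S_{\mathrm H}(P^k)$, with odd points $P^{k+1}_{2i+1}=(X_{2i+1},Y_{2i+1},Z_{2i+1})$, where $S_{\mathrm H}$ is the Heisenberg four-point subdivision operator. Put $p_i^k=(x_i^k,y_i^k)\in\mathbb{R}^2$ and $\Omega(p,q)=p_xq_y-p_yq_x$ for $p=(p_x,p_y),q=(q_x,q_y)\in\mathbb{R}^2$. Then for every $i\in\mathbb{Z}$, $$X_{2i+1}=-\omega x_{i-1}^k+(\tfrac12+\omega)x_i^k+(\tfrac12+\omega)x_{i+1}^k-\omega x_{i+2}^k,$$ $$Y_{2i+1}=-\omega y_{i-1}^k+(\tfrac12+\omega)y_i^k+(\tfrac12+\omega)y_{i+1}^k-\omega y_{i+2}^k,$$ $$Z_{2i+1}=-\omega z_{i-1}^k+(\tfrac12+\omega)z_i^k+(\tfrac12+\omega)z_{i+1}^k-\omega z_{i+2}^k-\tfrac{\omega}{2}\Omega(p_i^k,p_{i-1}^k)+\tfrac12(\tfrac12+\omega)\Omega(p_i^k,p_{i+1}^k)-\tfrac{\omega}{2}\Omega(p_i^k,p_{i+2}^k).$$ For $\omega=1/16$ the last formula reads $$Z_{2i+1}=-\tfrac1{16}z_{i-1}^k+\tfrac9{16}z_i^k+\tfrac9{16}z_{i+1}^k-\tfrac1{16}z_{i+2}^k+\tfrac1{32}(y_i^kx_{i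-1}^k-x_i^ky_{i-1}^k)+\tfrac9{32}(x_i^ky_{i+1}^k-y_i^kx_{i+1}^k)+\tfrac1{32}(y_i^kx_{i+2}^k-x_i^ky_{i+2}^k).$$
   Context: For a real sequence $u=\{u_i\}_{i\in\mathbb{Z}}$ the four-point operator $L_4$ with parameter $\omega$ is $(L_4u)_{2i}=u_i$, $(L_4u)_{2i+1}=-\omega u_{i-1}+(\tfrac12+\omega)u_i+(\tfrac12+\omega)u_{i+1}-\omega u_{i+2}$. The Heisenberg four-point subdivision operator $S_{\mathrm H}$ maps $P^k=\{(x_i^k,y_i^k,z_i^k)\}_{i\in\mathbb{Z}}\subset\mathbb{R}^3$ to $P^{k+1}$ defined by $P^{k+1}_{2i}=P^k_i$ and $P^{k+1}_{2i+1}=(X_{2i+1},Y_{2i+1},Z_{2i+1})$ with $X_{2i+1}=(L_4x^k)_{2i+1}$, $Y_{2i+1}=(L_4y^k)_{2i+1}$, $Z_{2i+1}=(L_4z^k)_{2i+1}+R_i^k$, where $R_i^k=\tfrac12(x_i^kb_i^k-y_i^ka_i^k)$, $a_i^k=X_{2i+1}-x_i^k$, $b_i^k=Y_{2i+1}-y_i^k$. *)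

theory Defs
  imports Complex_Main
begin

(* Output index j of a subdivided sequence is split by parity: j = 2 * i or j = 2 * i + 1
   with i = j div 2 (the floor, also for negative j). *)

definition four_point :: "real \<Rightarrow> (int \<Rightarrow> real) \<Rightarrow> int \<Rightarrow> real" where
  "four_point \<omega> u j =
     (let i = j div 2 in
      if even j then u i
      else - \<omega> * u (i - 1) + (1/2 + \<omega>) * u i + (1/2 + \<omega>) * u (i + 1) - \<omega> * u (i + 2))"

lemma four_point_even: "four_point \<omega> u (2 * i) = u i"
  by (simp add: four_point_def)

lemma four_point_odd:
  "four_point \<omega> u (2 * i + 1) =
     - \<omega> * u (i - 1) + (1/2 + \<omega>) * u i + (1/2 + \<omega>) * u (i + 1) - \<omega> * u (i + 2)"
  by (simp add: four_point_def)

(* The vertical correction R_i, where a and b are the horizontal increments from the i-th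
   point to the inserted point of index 2 * i + 1. *)
definition heisenberg_correction ::
    "real \<Rightarrow> (int \<Rightarrow> real) \<Rightarrow> (int \<Rightarrow> real) \<Rightarrow> int \<Rightarrow> real" where
  "heisenberg_correction \<omega> x y i =
     (let a = four_point \<omega> x (2 * i + 1) - x i;
          b = four_point \<omega> y (2 * i + 1) - y i
      in 1/2 * (x i * b - y i * a))"

definition heisenberg_subdivision ::
    "real \<Rightarrow> (int \<Rightarrow> real \<times> real \<times> real) \<Rightarrow> int \<Rightarrow> real \<times> real \<times> real" where
  "heisenberg_subdivision \<omega> P j =
     (let x = (\<lambda>i. fst (P i));
          y = (\<lambda>i. fst (snd (P i)));
          z = (\<lambda>i. snd (snd (P i)))
      in if even j then P (j div 2)
         else (four_point \<omega> x j,
               four_point \<omega> y j,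
               four_point \<omega> z j + heisenberg_correction \<omega> x y (j div 2)))"

definition symplectic_form :: "real \<times> real \<Rightarrow> real \<times> real \<Rightarrow> real" where
  "symplectic_form p q = fst p * snd q - snd p * fst q"

end

theory Submission
  imports Defs
begin

text \<open>
  The correction term is half of $\Omega(p_i, q - p_i)$, where $q$ is the horizontal part of the
  inserted point. Since $\Omega$ is alternating, the subtraction of $p_i$ has no effect, so the
  correction is half of $\Omega(p_i, q)$. As $q$ is the four-point combination of
  $p_{i-1}, p_i, p_{i+1}, p_{i+2}$, linearity of $\Omega$ in its second argument distributes the
  mask over the four neighbours, and the contribution of $p_i$ itself vanishes. This is
  why only three symplectic terms remain, each with half the mask weight of its neighbour.
  The formula for $\omega = 1/16$ is this identity with the forms written out in coordinates.
\<close>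

text \<open>
  The increment $q - p_i$ may be replaced by $q$ because $\Omega(p_i, p_i) = 0$. Geometrically,
  the correction is the signed area of the triangle with vertices $0$, $p_i$ and $q$.
\<close>

lemma heisenberg_correction_eq_half_symplectic_form:
  "heisenberg_correction \<omega> x y i =
     1/2 * symplectic_form (x i, y i) (four_point \<omega> x (2 * i + 1), four_point \<omega> y (2 * i + 1))"
  by (simp add: heisenberg_correction_def symplectic_form_def Let_def field_simps)

text \<open>
  Bilinearity alone would give a fourth term, with weight $1/2 + \omega$ on
  $\Omega(p_i, p_i)$; it is absent because the form is alternating.
\<close>

lemma symplectic_form_four_point_odd:
  "symplectic_form (x i, y i) (four_point \<omega> x (2 * i + 1), four_point \<omega> y (2 * i + 1)) =
     - \<omega> * symplectic_form (x i, y i) (x (i - 1), y (i - 1))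
     + (1/2 + \<omega>) * symplectic_form (x i, y i) (x (i + 1), y (i + 1))
     - \<omega> * symplectic_form (x i, y i) (x (i + 2), y (i + 2))"
  unfolding four_point_odd symplectic_form_def fst_conv snd_conv
  by algebra

lemma heisenberg_subdivision_odd:
  assumes "\<And>i. P i = (x i, y i, z i)"
  shows "heisenberg_subdivision \<omega> P (2 * i + 1) =
           (four_point \<omega> x (2 * i + 1), four_point \<omega> y (2 * i + 1),
            four_point \<omega> z (2 * i + 1) + heisenberg_correction \<omega> x y i)"
  using assms by (simp add: heisenberg_subdivision_def)

theorem proposition4p2:
  fixes \<omega> :: real
    and x y z X Y Z :: "int \<Rightarrow> real"
    and P P' :: "int \<Rightarrow> real \<times> real \<times> real"
    and p :: "int \<Rightarrow> real \<times> real"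
  assumes "0 < \<omega>" and "\<omega> < 1/8"
    and "\<And>i. P i = (x i, y i, z i)"
    and "P' = heisenberg_subdivision \<omega> P"
    and "\<And>i. P' (2 * i + 1) = (X (2 * i + 1), Y (2 * i + 1), Z (2 * i + 1))"
    and "\<And>i. p i = (x i, y i)"
  shows "(\<forall>i.
      X (2 * i + 1) =
        - \<omega> * x (i - 1) + (1/2 + \<omega>) * x i + (1/2 + \<omega>) * x (i + 1) - \<omega> * x (i + 2) \<and>
      Y (2 * i + 1) =
        - \<omega> * y (i - 1) + (1/2 + \<omega>) * y i + (1/2 + \<omega>) * y (i + 1) - \<omega> * y (i + 2) \<and>
      Z (2 * i + 1) =
        - \<omega> * z (i - 1) + (1/2 + \<omega>) * z i + (1/2 + \<omega>) * z (i + 1) - \<omega> * z (i + 2)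
        - \<omega> / 2 * symplectic_form (p i) (p (i - 1))
        + 1/2 * (1/2 + \<omega>) * symplectic_form (p i) (p (i + 1))
        - \<omega> / 2 * symplectic_form (p i) (p (i + 2))) \<and>
    (\<omega> = 1/16 \<longrightarrow> (\<forall>i.
      Z (2 * i + 1) =
        - (1/16) * z (i - 1) + 9/16 * z i + 9/16 * z (i + 1) - 1/16 * z (i + 2)
        + 1/32 * (y i * x (i - 1) - x i * y (i - 1))
        + 9/32 * (x i * y (i + 1) - y i * x (i + 1))
        + 1/32 * (y i * x (i + 2) - x i * y (i + 2))))"
proof -
  have odd: "X (2 * i + 1) = four_point \<omega> x (2 * i + 1)"
    "Y (2 * i + 1) = four_point \<omega> y (2 * i + 1)"
    "Z (2 * i + 1) = four_point \<omega> z (2 * i + 1) + heisenberg_correction \<omega> x y i" for i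
    using heisenberg_subdivision_odd[where \<omega> = \<omega> and i = i, OF assms(3)] assms(5)[of i]
    unfolding assms(4) by simp_all
  have Z: "Z (2 * i + 1) =
        - \<omega> * z (i - 1) + (1/2 + \<omega>) * z i + (1/2 + \<omega>) * z (i + 1) - \<omega> * z (i + 2)
        - \<omega> / 2 * symplectic_form (p i) (p (i - 1))
        + 1/2 * (1/2 + \<omega>) * symplectic_form (p i) (p (i + 1))
        - \<omega> / 2 * symplectic_form (p i) (p (i + 2))" for i
    unfolding odd(3) heisenberg_correction_eq_half_symplectic_form
      symplectic_form_four_point_odd assms(6)
    unfolding four_point_odd[of _ z] by (simp add: algebra_simps)
  have "Z (2 * i + 1) =
        - (1/16) * z (i - 1) + 9/16 * z i + 9/16 * z (i + 1) - 1/16 * z (i + 2)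
        + 1/32 * (y i * x (i - 1) - x i * y (i - 1))
        + 9/32 * (x i * y (i + 1) - y i * x (i + 1))
        + 1/32 * (y i * x (i + 2) - x i * y (i + 2))" if "\<omega> = 1/16" for i
    unfolding Z that assms(6) symplectic_form_def fst_conv snd_conv
    by (simp add: field_simps)
  with odd(1,2) Z show ?thesis
    unfolding four_point_odd by blast
qed

end
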